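(* Let $M=(M_p)_{p\in\mathbb{N}}\in\mathcal{LC}$ and $c>0$. Assume that there exist a strictly increasing sequence of nonnegative integers $(a_j)_{j\ge1}$ and constants $K\ge b>2$ such that for all $j\ge 1$ $$b\le\min\{A_M(a_j,a_{j+1}),B_M(a_j,a_{j+1})\}\le\max\{A_M(a_j,a_{j+1}),B_M(a_j,a_{j+1})\}\le K.$$ Then the solid core of $H^{\infty}_{v_{M,c}}(\mathbb{C})$ is $$s(H^{\infty}_{v_{M,c}}(\mathbb{C}))=\left\{(b_j)_{j\in\mathbb{N}}\in\mathbb{C}^{\mathbb{N}}:\ \sup_{j\ge1}v_{M,c}(r_{a_j,c})\sum_{a_j<l\le a_{j+1}}|b_l|(r_{a_j,c})^{l}<+\infty\right\},$$ where $r_{a_j,c}=\mu_{a_j+1}/c$, or equivalently $$s(H^{\infty}_{v_{M,c}}(\mathbb{C}))=\left\{(b_j)_{j\in\mathbb{N}}\in\mathbb{C}^{\mathbb{N}}:\ \sup_{j\ge1}\frac{M_{a_j+1}}{(\mu_{a_j+1})^{a_j+1}}\sum_{a_j<l\le a_{j+1}}|b_l|\left(\frac{\mu_{a_j+1}}{c}\right)^{l}<+\infty\right\}.$$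
   Context: $\mathbb{N}=\{0,1,2,\dots\}$. For a sequence $M=(M_p)_{p\in\mathbb{N}}$ of positive reals put $\mu_p:=M_p/M_{p-1}$ for $p\ge1$ and $\mu_0:=1$. $\mathcal{LC}$ is the set of all such $M$ with $M_0=1\le M_1$, $M_p^2\le M_{p-1}M_{p+1}$ for all $p\ge1$, and $\lim_{p\to\infty}(M_p)^{1/p}=+\infty$. The associated weight function is $\omega_M(t):=\sup_{p\in\mathbb{N}}\log(t^p/M_p)$ for $t>0$, $\omega_M(0):=0$. For $c>0$ set $v_{M,c}(r):=\exp(-\omega_M(cr))$, $r\ge0$, and $H^{\infty}_{v_{M,c}}(\mathbb{C}):=\{f \text{ entire}:\ \sup_{z\in\mathbb{C}}|f(z)|v_{M,c}(|z|)<+\infty\}$; an entire function $f(z)=\sum_{j\ge0}a_jz^j$ is identified with its sequence of Taylor coefficients $(a_j)_{j\in\mathbb{N}}$. For integers $0\le k<l$, $$A_M(k,l):=\frac{(\mu_{l+1})^{l-k}}{\mu_{k+1}\cdots\mu_l},\qquad B_M(k,l):=\frac{\mu_{k+1}\cdots\mu_l}{(\mu_{k+1})^{l-k}}.$$ A vector space $A$ of complex sequences is solid if $(a_j)_j\in A$ and $|b_j|\le|a_j|$ for all $j$ imply $(b_j)_j\in A$. The solid core $s(A)$ is the largest solid subspace: $s(A)=\{(b_j)_j:(b_j\lambda_j)_j\in A\ \forall(\lambda_j)_j\in\ell^\infty\}$. *)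

theory Defs
  imports "HOL-Complex_Analysis.Complex_Analysis" "HOL-Library.Function_Algebras"
begin

definition LC :: "(nat \<Rightarrow> real) set" where
  "LC = {M. (\<forall>p. 0 < M p) \<and> M 0 = 1 \<and> 1 \<le> M 1 \<and>
            (\<forall>p\<ge>1. (M p)\<^sup>2 \<le> M (p - 1) * M (p + 1)) \<and>
            filterlim (\<lambda>p. root p (M p)) at_top sequentially}"

definition mu :: "(nat \<Rightarrow> real) \<Rightarrow> nat \<Rightarrow> real" where
  "mu M p = (if p = 0 then 1 else M p / M (p - 1))"

text \<open>The supremum is taken in the reals; for \<open>M \<in> LC\<close> and \<open>t > 0\<close> it is finite, see
  \<open>bdd_above_omega\<close> below.  Only \<open>t \<ge> 0\<close> is meaningful.\<close>

definition omega :: "(nat \<Rightarrow> real) \<Rightarrow> real \<Rightarrow> real" where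
  "omega M t = (if t = 0 then 0 else (SUP p. ln (t ^ p / M p)))"

definition weight :: "(nat \<Rightarrow> real) \<Rightarrow> real \<Rightarrow> real \<Rightarrow> real" where
  "weight M c r = exp (- omega M (c * r))"

definition A_quot :: "(nat \<Rightarrow> real) \<Rightarrow> nat \<Rightarrow> nat \<Rightarrow> real" where
  "A_quot M k l = mu M (l + 1) ^ (l - k) / (\<Prod>i=k+1..l. mu M i)"

definition B_quot :: "(nat \<Rightarrow> real) \<Rightarrow> nat \<Rightarrow> nat \<Rightarrow> real" where
  "B_quot M k l = (\<Prod>i=k+1..l. mu M i) / mu M (k + 1) ^ (l - k)"

definition H_inf :: "(real \<Rightarrow> real) \<Rightarrow> (complex \<Rightarrow> complex) set" where
  "H_inf v = {f. f holomorphic_on UNIV \<and> bdd_above (range (\<lambda>z. norm (f z) * v (norm z)))}"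

definition taylor_coeffs :: "(complex \<Rightarrow> complex) \<Rightarrow> nat \<Rightarrow> complex" where
  "taylor_coeffs f j = (deriv ^^ j) f 0 / fact j"

definition H_inf_seq :: "(real \<Rightarrow> real) \<Rightarrow> (nat \<Rightarrow> complex) set" where
  "H_inf_seq v = taylor_coeffs ` H_inf v"

definition solid :: "(nat \<Rightarrow> complex) set \<Rightarrow> bool" where
  "solid A \<longleftrightarrow> (\<forall>a\<in>A. \<forall>b. (\<forall>j. norm (b j) \<le> norm (a j)) \<longrightarrow> b \<in> A)"

text \<open>The lemmas \<open>solid_core_subset\<close>, \<open>solid_solid_core\<close>, \<open>subspace_solid_core\<close> and
  \<open>solid_core_greatest\<close> below show that this is the largest solid subspace of \<open>A\<close>.\<close>

definition solid_core :: "(nat \<Rightarrow> complex) set \<Rightarrow> (nat \<Rightarrow> complex) set" where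
  "solid_core A = {b. \<forall>l. bounded (range l) \<longrightarrow> (\<lambda>j. b j * l j) \<in> A}"

abbreviation seq_subspace :: "(nat \<Rightarrow> complex) set \<Rightarrow> bool" where
  "seq_subspace \<equiv> module.subspace (\<lambda>(c::complex) (x::nat \<Rightarrow> complex) j. c * x j)"

lemma bdd_above_omega:
  assumes "M \<in> LC" "t > 0"
  shows "bdd_above (range (\<lambda>p. ln (t ^ p / M p)))"
proof -
  have pos: "M p > 0" for p using assms by (simp add: LC_def)
  have "filterlim (\<lambda>p. root p (M p)) at_top sequentially"
    using assms by (simp add: LC_def)
  then have "eventually (\<lambda>p. t \<le> root p (M p)) sequentially"
    by (simp add: filterlim_at_top)
  then have "eventually (\<lambda>p. ln (t ^ p / M p) \<le> 0) sequentially"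
    using eventually_gt_at_top[of 0]
  proof eventually_elim
    case (elim p)
    have "t ^ p \<le> root p (M p) ^ p"
      using elim assms by (intro power_mono) auto
    also have "\<dots> = M p" using elim pos[of p] by simp
    finally show ?case using pos[of p] assms by (simp add: field_simps)
  qed
  then obtain N where N: "\<And>p. p \<ge> N \<Longrightarrow> ln (t ^ p / M p) \<le> 0"
    by (auto simp: eventually_sequentially)
  have "range (\<lambda>p. ln (t ^ p / M p)) \<subseteq> (\<lambda>p. ln (t ^ p / M p)) ` {..<N} \<union> {..0}"
  proof
    fix y assume "y \<in> range (\<lambda>p. ln (t ^ p / M p))"
    then obtain p where "y = ln (t ^ p / M p)" by blast
    then show "y \<in> (\<lambda>p. ln (t ^ p / M p)) ` {..<N} \<union> {..0}"
      using N[of p] by (cases "p < N") auto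
  qed
  moreover have "bdd_above ((\<lambda>p. ln (t ^ p / M p)) ` {..<N} \<union> {..0})"
    by (simp add: bdd_above_Un)
  ultimately show ?thesis by (rule bdd_above_mono[rotated])
qed

lemma taylor_coeffs_sums:
  assumes "f holomorphic_on UNIV"
  shows "(\<lambda>j. taylor_coeffs f j * z ^ j) sums f z"
proof -
  have "f holomorphic_on ball 0 (norm z + 1)"
    using assms by (rule holomorphic_on_subset) simp
  from holomorphic_power_series[OF this, of z] show ?thesis
    by (simp add: taylor_coeffs_def)
qed

lemma inj_on_taylor_coeffs: "inj_on taylor_coeffs (H_inf v)"
proof (rule inj_onI)
  fix f g assume "f \<in> H_inf v" "g \<in> H_inf v" and eq: "taylor_coeffs f = taylor_coeffs g"
  then have "f z = g z" for z
    using taylor_coeffs_sums[of f z] taylor_coeffs_sums[of g z]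
    by (auto simp: H_inf_def intro: sums_unique2)
  then show "f = g" by auto
qed

lemma module_seq: "module (\<lambda>(c::complex) (x::nat \<Rightarrow> complex) j. c * x j)"
  by unfold_locales (auto simp: algebra_simps fun_eq_iff)

lemma solid_core_subset: "solid_core A \<subseteq> A"
proof
  fix b assume "b \<in> solid_core A"
  moreover have "bounded (range (\<lambda>_::nat. 1::complex))" by (auto simp: bounded_iff)
  ultimately have "(\<lambda>j. b j * 1) \<in> A"
    unfolding solid_core_def by blast
  then show "b \<in> A" by simp
qed

lemma solid_solid_core: "solid (solid_core A)"
  unfolding solid_def
proof (intro ballI allI impI)
  fix a b :: "nat \<Rightarrow> complex" assume a: "a \<in> solid_core A" and le: "\<forall>j. norm (b j) \<le> norm (a j)"
  show "b \<in> solid_core A"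
    unfolding solid_core_def
  proof (intro CollectI allI impI)
    fix l :: "nat \<Rightarrow> complex" assume "bounded (range l)"
    then obtain C where C: "\<And>j. norm (l j) \<le> C" by (auto simp: bounded_iff)
    define q where "q j = (if a j = 0 then 0 else b j / a j)" for j
    have q1: "norm (q j) \<le> 1" for j
      using le by (auto simp: q_def norm_divide divide_simps)
    have "norm (q j * l j) \<le> 1 * C" for j
      unfolding norm_mult using q1 C by (intro mult_mono) auto
    then have "bounded (range (\<lambda>j. q j * l j))" by (auto simp: bounded_iff)
    then have "(\<lambda>j. a j * (q j * l j)) \<in> A"
      using a unfolding solid_core_def by blast
    moreover have "a j * (q j * l j) = b j * l j" for j
      using spec[OF le, of j] by (cases "a j = 0") (simp_all add: q_def)
    ultimately show "(\<lambda>j. b j * l j) \<in> A" by simp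
  qed
qed

lemma subspace_solid_core:
  assumes "seq_subspace A"
  shows "seq_subspace (solid_core A)"
proof -
  interpret module "\<lambda>(c::complex) (x::nat \<Rightarrow> complex) j. c * x j" by (rule module_seq)
  show ?thesis
  proof (rule subspaceI)
    have "(\<lambda>j. 0) \<in> A" using subspace_0[OF assms] by (simp add: zero_fun_def)
    then show "0 \<in> solid_core A" by (simp add: solid_core_def)
  next
    fix x y assume "x \<in> solid_core A" "y \<in> solid_core A"
    then have "(\<lambda>j. x j * l j) + (\<lambda>j. y j * l j) \<in> A" if "bounded (range l)" for l
      using that by (intro subspace_add[OF assms]) (auto simp: solid_core_def)
    then show "x + y \<in> solid_core A"
      by (simp add: solid_core_def plus_fun_def distrib_right)
  next
    fix c x assume "x \<in> solid_core A"
    then have "(\<lambda>j. c * (x j * l j)) \<in> A" if "bounded (range l)" for l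
      using that by (intro subspace_scale[OF assms]) (auto simp: solid_core_def)
    then show "(\<lambda>j. c * x j) \<in> solid_core A"
      by (simp add: solid_core_def mult.assoc)
  qed
qed

lemma solid_core_greatest:
  assumes "seq_subspace S" "solid S" "S \<subseteq> A"
  shows "S \<subseteq> solid_core A"
proof
  interpret module "\<lambda>(c::complex) (x::nat \<Rightarrow> complex) j. c * x j" by (rule module_seq)
  fix b assume b: "b \<in> S"
  show "b \<in> solid_core A"
    unfolding solid_core_def
  proof (intro CollectI allI impI)
    fix l :: "nat \<Rightarrow> complex" assume "bounded (range l)"
    then obtain C where C: "\<And>j. norm (l j) \<le> C" by (auto simp: bounded_iff)
    have "C \<ge> 0" using C[of 0] norm_ge_zero order_trans by blast
    have "(\<lambda>j. of_real C * b j) \<in> S" using subspace_scale[OF assms(1) b] .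
    moreover have "norm (b j * l j) \<le> norm (of_real C * b j)" for j
      using mult_right_mono[OF C[of j], of "norm (b j)"] \<open>C \<ge> 0\<close>
      by (simp add: norm_mult mult.commute)
    ultimately have "(\<lambda>j. b j * l j) \<in> S"
      using assms(2) unfolding solid_def by (meson)
    then show "(\<lambda>j. b j * l j) \<in> A" using assms(3) by blast
  qed
qed

end

theory Submission
  imports Defs
begin

text \<open>
  Two observations reduce the theorem to an estimate for nonnegative series.  Write \<open>v\<close> for the
  weight, and substitute \<open>w\<^sub>l = \<bar>b\<^sub>l\<bar> / c\<^sup>l\<close>, \<open>s = c r\<close> to absorb the dilation by \<open>c\<close>.

  First, multiplying the coefficients of a member of the solid core by unimodular numbers makes
  them nonnegative, and a power series with nonnegative coefficients is largest on the positive
  half-line.  So \<open>b\<close> lies in the solid core exactly when \<open>v(r) \<Sum>\<^sub>l \<bar>b\<^sub>l\<bar> r\<^sup>l\<close> is bounded in \<open>r \<ge> 0\<close>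
  (\<open>solid_core_H_inf_iff\<close>).  In particular every block sum at every radius is bounded, which is
  one inclusion.

  Second, \<open>v(s/c) = inf\<^sub>p M\<^sub>p / s\<^sup>p\<close>, and by log-convexity the infimum at \<open>s = \<mu>\<^bsub>p+1\<^esub>\<close> is attained at
  the index \<open>p\<close> and also at \<open>p + 1\<close> (\<open>weight_at_mu\<close>, \<open>weight_at_mu_Suc\<close>).  This makes the two
  descriptions in the theorem the same, and it turns the hypothesis on the \<open>j\<close>-th block into
  a bound for \<open>\<Sum> w\<^sub>l t\<^sub>j\<^sup>l\<close> at the single point \<open>t\<^sub>j = \<mu>\<^bsub>a\<^sub>j+1\<^esub>\<close>.

  For the other inclusion let \<open>t\<^sub>k \<le> s \<le> t\<^bsub>k+1\<^esub>\<close>, with \<open>k = 0\<close> if \<open>s < t\<^sub>1\<close>.  Moving from \<open>t\<^sub>j\<close> to \<open>s\<close> multiplies the \<open>j\<close>-th block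
  at most by \<open>(s/t\<^sub>j)\<^sup>p\<close>, where \<open>p = a\<^bsub>j+1\<^esub>\<close> if \<open>s\<close> lies to the right of \<open>t\<^sub>j\<close> and \<open>p = a\<^sub>j\<close> if it lies to
  the left.  The weight at \<open>s\<close> is at most \<open>M\<^sub>q / s\<^sup>q\<close> with \<open>q = a\<^sub>k\<close> or \<open>q = a\<^bsub>k+1\<^esub>\<close>.  The quotients \<open>A\<close> and
  \<open>B\<close> measure by how much these powers miss the corresponding quotients of \<open>M\<close>: the bound
  \<open>B \<le> K\<close> limits the loss of moving a block away from its node to the factor \<open>K\<close>, and each full
  block between the \<open>j\<close>-th one and \<open>s\<close> gains a factor \<open>1/\<beta>\<close>, from \<open>A \<ge> \<beta>\<close> for the blocks to the left of \<open>s\<close> (\<open>decay_above_node\<close>) and from \<open>B \<ge> \<beta>\<close> for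
  those to the right (\<open>decay_below_node\<close>).  Hence the \<open>j\<close>-th block contributes at most a constant
  times \<open>\<beta>\<close> to the power \<open>-\<bar>k - j\<bar>\<close> (\<open>block_decay\<close>), and summing over \<open>j\<close> gives a bound uniform
  in \<open>s\<close> (\<open>partial_sums_bounded\<close>).
\<close>

section \<open>Log-convex sequences and their weights\<close>

lemma LC_pos: "M \<in> LC \<Longrightarrow> 0 < M p"
  by (simp add: LC_def)

lemma mu_pos: "M \<in> LC \<Longrightarrow> 0 < mu M p"
  by (simp add: mu_def LC_pos)

lemma mu_mono:
  assumes M: "M \<in> LC" and "p \<le> q"
  shows "mu M p \<le> mu M q"
proof (rule lift_Suc_mono_le[OF _ \<open>p \<le> q\<close>])
  fix n
  show "mu M n \<le> mu M (Suc n)"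
  proof (cases n)
    case 0
    then show ?thesis using M by (simp add: mu_def LC_def)
  next
    case (Suc m)
    have "(M n)\<^sup>2 \<le> M (n - 1) * M (n + 1)"
      using M Suc by (auto simp: LC_def)
    then show ?thesis
      using Suc LC_pos[OF M, of m] LC_pos[OF M, of n]
      by (simp add: mu_def field_simps power2_eq_square)
  qed
qed

lemma LC_ratio:
  assumes M: "M \<in> LC" and "k \<le> l"
  shows "M l = M k * (\<Prod>i=k+1..l. mu M i)"
  using \<open>k \<le> l\<close>
proof (induction l rule: dec_induct)
  case base
  show ?case by simp
next
  case (step n)
  have "M (Suc n) = M n * mu M (Suc n)"
    using LC_pos[OF M, of n] by (simp add: mu_def)
  with step show ?case
    by simp
qed

lemma LC_ge_power:
  assumes M: "M \<in> LC" and "k \<le> l"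
  shows "M k * mu M (k + 1) ^ (l - k) \<le> M l"
proof -
  have "(\<Prod>i=k+1..l. mu M (k+1)) \<le> (\<Prod>i=k+1..l. mu M i)"
    using mu_pos[OF M] by (intro prod_mono) (auto intro: less_imp_le mu_mono[OF M])
  then show ?thesis
    using LC_pos[OF M, of k] by (simp add: LC_ratio[OF assms])
qed

lemma LC_le_power:
  assumes M: "M \<in> LC" and "k \<le> l"
  shows "M l \<le> M k * mu M (l + 1) ^ (l - k)"
proof -
  have "(\<Prod>i=k+1..l. mu M i) \<le> (\<Prod>i=k+1..l. mu M (l+1))"
    using mu_pos[OF M] by (intro prod_mono) (auto intro: less_imp_le mu_mono[OF M])
  then show ?thesis
    using LC_pos[OF M, of k] by (simp add: LC_ratio[OF assms])
qed

text \<open>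
  The sequence \<open>ln M\<close> is convex, so the line through \<open>(p, ln M\<^sub>p)\<close> with slope \<open>ln \<mu>\<^bsub>p+1\<^esub>\<close>, which also
  passes through \<open>(p + 1, ln M\<^bsub>p+1\<^esub>)\<close>, supports its graph from below.
\<close>

lemma LC_tangent:
  assumes M: "M \<in> LC"
  shows "M p * mu M (p + 1) ^ q \<le> M q * mu M (p + 1) ^ p"
proof (cases "p \<le> q")
  case True
  then obtain d where "q = p + d" using le_Suc_ex by blast
  then show ?thesis
    using mult_right_mono[OF LC_ge_power[OF M True], of "mu M (p+1) ^ p"] mu_pos[OF M, of "p+1"]
    by (simp add: power_add mult_ac)
next
  case False
  then obtain d where "p = q + d" using le_Suc_ex nat_le_linear by blast
  then show ?thesis
    using mult_right_mono[OF LC_le_power[OF M, of q p], of "mu M (p+1) ^ q"] mu_pos[OF M, of "p+1"]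
    by (simp add: power_add mult_ac)
qed

lemma weight_times_power_le:
  assumes M: "M \<in> LC" and "c > 0" "r > 0"
  shows "weight M c r * (c * r) ^ p \<le> M p"
proof -
  have cr: "c * r > 0" using assms by simp
  have "ln ((c * r) ^ p / M p) \<le> omega M (c * r)"
    using cr assms bdd_above_omega[OF M cr] by (auto simp: omega_def intro: cSUP_upper)
  then have "(c * r) ^ p / M p \<le> exp (omega M (c * r))"
    using cr LC_pos[OF M, of p] by (metis divide_pos_pos exp_le_cancel_iff exp_ln zero_less_power)
  then show ?thesis
    using LC_pos[OF M, of p] by (simp add: weight_def exp_minus field_simps)
qed

text \<open>
  The point \<open>\<mu>\<^bsub>p+1\<^esub>\<close> is the slope of the supporting line of \<open>LC_tangent\<close>, so index \<open>p\<close> realises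
  the supremum that defines the weight function there.
\<close>

lemma weight_at_mu:
  assumes M: "M \<in> LC" and "c > 0"
  shows "weight M c (mu M (p + 1) / c) = M p / mu M (p + 1) ^ p"
proof -
  let ?t = "mu M (p + 1)"
  have t: "?t > 0" by (rule mu_pos[OF M])
  have "(SUP q. ln (?t ^ q / M q)) = ln (?t ^ p / M p)"
  proof (rule cSup_eq_maximum)
    fix y assume "y \<in> range (\<lambda>q. ln (?t ^ q / M q))"
    then obtain q where y: "y = ln (?t ^ q / M q)" by blast
    have "?t ^ q / M q \<le> ?t ^ p / M p"
      using LC_tangent[OF M, of p q] LC_pos[OF M, of p] LC_pos[OF M, of q]
      by (simp add: field_simps)
    then show "y \<le> ln (?t ^ p / M p)"
      using t LC_pos[OF M, of q] LC_pos[OF M, of p] by (simp add: y ln_le_cancel_iff del: ln_div)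
  qed auto
  then have "omega M (c * (?t / c)) = ln (?t ^ p / M p)"
    using t \<open>c > 0\<close> by (simp add: omega_def)
  then show ?thesis
    using t LC_pos[OF M, of p] by (simp add: weight_def exp_minus)
qed

lemma weight_at_mu_Suc:
  assumes M: "M \<in> LC" and "c > 0"
  shows "weight M c (mu M (p + 1) / c) = M (p + 1) / mu M (p + 1) ^ (p + 1)"
proof -
  have "M (p + 1) = M p * mu M (p + 1)"
    using LC_pos[OF M, of p] by (simp add: mu_def)
  then show ?thesis
    using mu_pos[OF M, of "p+1"] by (simp only: weight_at_mu[OF assms]) simp
qed

section \<open>The solid core of a weighted space of entire functions\<close>

lemma taylor_coeffs_eqI:
  assumes "\<And>z. (\<lambda>l. a l * z ^ l) sums f z"
  shows "taylor_coeffs f = a"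
proof
  fix j
  have "f has_fps_expansion Abs_fps a"
    using assms by (intro has_fps_expansionI always_eventually) simp
  from fps_nth_fps_expansion[OF this, of j] show "taylor_coeffs f j = a j"
    by (simp add: taylor_coeffs_def)
qed

text \<open>
  Bounding only partial sums keeps convergence out of the hypothesis: positivity of \<open>v\<close> yields
  absolute convergence at every point, hence an entire function.
\<close>

lemma H_inf_seqI:
  assumes v: "\<And>r. r \<ge> 0 \<Longrightarrow> v r > 0"
    and C: "\<And>r n. r \<ge> 0 \<Longrightarrow> v r * (\<Sum>l<n. norm (a l) * r ^ l) \<le> C"
  shows "a \<in> H_inf_seq v"
proof -
  have sm: "summable (\<lambda>l. norm (a l * z ^ l))" for z
  proof (rule bounded_imp_summable)
    fix n
    have "v (norm z) * (\<Sum>l\<le>n. norm (a l * z ^ l)) \<le> C"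
      using C[of "norm z" "Suc n"] by (simp add: norm_mult norm_power lessThan_Suc_atMost)
    then show "(\<Sum>l\<le>n. norm (a l * z ^ l)) \<le> C / v (norm z)"
      using v[of "norm z"] by (simp add: field_simps)
  qed simp
  define f where "f z = (\<Sum>l. a l * z ^ l)" for z
  have sums: "(\<lambda>l. a l * z ^ l) sums f z" for z
    unfolding f_def using summable_norm_cancel[OF sm] by (rule summable_sums)
  have hol: "f holomorphic_on UNIV"
  proof (rule holomorphic_onI)
    fix z :: complex
    have "f holomorphic_on ball 0 (norm z + 1)"
      using sums by (intro power_series_holomorphic[where a = a]) auto
    then have "f field_differentiable at z"
      by (rule holomorphic_on_imp_differentiable_at) auto
    then show "f field_differentiable at z within UNIV" .
  qed
  have "norm (f z) * v (norm z) \<le> C" for z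
  proof -
    have "v (norm z) * norm (f z) \<le> v (norm z) * (\<Sum>l. norm (a l * z ^ l))"
      unfolding f_def using v[of "norm z"] by (intro mult_left_mono summable_norm sm) auto
    also have "\<dots> \<le> C"
    proof -
      have "(\<Sum>l. norm (a l * z ^ l)) \<le> C / v (norm z)"
        using C[of "norm z"] v[of "norm z"]
        by (intro suminf_le_const sm) (simp add: norm_mult norm_power field_simps)
      then show ?thesis
        using v[of "norm z"] by (simp add: field_simps)
    qed
    finally show ?thesis by (simp add: mult.commute)
  qed
  then have "f \<in> H_inf v"
    using hol by (auto simp: H_inf_def bdd_above_def)
  then show ?thesis
    using taylor_coeffs_eqI[OF sums] unfolding H_inf_seq_def by blast
qed

text \<open>
  On the solid core the supremum norm of the weighted space becomes a weighted \<open>l\<^sup>1\<close> norm: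
  choosing the multiplier to rotate all coefficients onto the positive axis gives necessity.
  Conversely, the condition is insensitive to bounded multipliers and dominates the function
  by the triangle inequality.
\<close>

lemma solid_core_H_inf_iff:
  assumes v: "\<And>r. r \<ge> 0 \<Longrightarrow> v r > 0"
  shows "b \<in> solid_core (H_inf_seq v) \<longleftrightarrow>
    (\<exists>C. \<forall>r\<ge>0. \<forall>n. v r * (\<Sum>l<n. norm (b l) * r ^ l) \<le> C)"
proof
  assume b: "b \<in> solid_core (H_inf_seq v)"
  \<comment> \<open>The multiplier that rotates each coefficient onto the nonnegative axis.\<close>
  define u where "u l = (if b l = 0 then 0 else cnj (b l) / norm (b l))" for l
  have "norm (u l) \<le> 1" for l
    by (simp add: u_def norm_divide)
  then have "bounded (range u)" by (auto simp: bounded_iff)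
  moreover have "b l * u l = of_real (norm (b l))" for l
    using complex_norm_square[of "b l"] by (auto simp: u_def field_simps power2_eq_square)
  ultimately have "(\<lambda>l. of_real (norm (b l))) \<in> H_inf_seq v"
    using b by (auto simp: solid_core_def)
  then obtain f where f: "f \<in> H_inf v" "taylor_coeffs f = (\<lambda>l. of_real (norm (b l)))"
    by (auto simp: H_inf_seq_def)
  then obtain C where C: "\<And>z. norm (f z) * v (norm z) \<le> C" and hol: "f holomorphic_on UNIV"
    by (auto simp: H_inf_def bdd_above_def)
  have "v r * (\<Sum>l<n. norm (b l) * r ^ l) \<le> C" if "r \<ge> 0" for r n
  proof -
    have "(\<lambda>l. complex_of_real (norm (b l) * r ^ l)) sums f (of_real r)"
      using taylor_coeffs_sums[OF hol, of "of_real r"] f by simp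
    then have s: "(\<lambda>l. norm (b l) * r ^ l) sums Re (f (of_real r))"
      using sums_Re by fastforce
    have "(\<Sum>l<n. norm (b l) * r ^ l) \<le> Re (f (of_real r))"
      using sum_le_suminf[OF sums_summable[OF s], of "{..<n}"] \<open>r \<ge> 0\<close> sums_unique[OF s] by simp
    also have "\<dots> \<le> norm (f (of_real r))" by (rule complex_Re_le_cmod)
    finally have "v r * (\<Sum>l<n. norm (b l) * r ^ l) \<le> v r * norm (f (of_real r))"
      using v[OF that] by simp
    also have "\<dots> \<le> C" using C[of "of_real r"] that by (simp add: mult.commute)
    finally show ?thesis .
  qed
  then show "\<exists>C. \<forall>r\<ge>0. \<forall>n. v r * (\<Sum>l<n. norm (b l) * r ^ l) \<le> C" by blast
next
  assume "\<exists>C. \<forall>r\<ge>0. \<forall>n. v r * (\<Sum>l<n. norm (b l) * r ^ l) \<le> C"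
  then obtain C where C: "\<And>r n. r \<ge> 0 \<Longrightarrow> v r * (\<Sum>l<n. norm (b l) * r ^ l) \<le> C" by blast
  show "b \<in> solid_core (H_inf_seq v)"
    unfolding solid_core_def
  proof (intro CollectI allI impI)
    fix u :: "nat \<Rightarrow> complex" assume "bounded (range u)"
    then obtain D where D: "\<And>l. norm (u l) \<le> D" by (auto simp: bounded_iff)
    have "D \<ge> 0" using D[of 0] norm_ge_zero order_trans by blast
    show "(\<lambda>l. b l * u l) \<in> H_inf_seq v"
    proof (rule H_inf_seqI[OF v])
      fix r :: real and n :: nat assume r: "r \<ge> 0"
      have "norm (b l * u l) * r ^ l \<le> D * (norm (b l) * r ^ l)" for l
      proof -
        have "norm (u l) * (norm (b l) * r ^ l) \<le> D * (norm (b l) * r ^ l)"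
          using D r by (intro mult_right_mono) auto
        then show ?thesis by (simp add: norm_mult mult_ac)
      qed
      then have "(\<Sum>l<n. norm (b l * u l) * r ^ l) \<le> D * (\<Sum>l<n. norm (b l) * r ^ l)"
        by (simp add: sum_distrib_left sum_mono)
      then have "v r * (\<Sum>l<n. norm (b l * u l) * r ^ l) \<le> v r * (D * (\<Sum>l<n. norm (b l) * r ^ l))"
        using v[OF r] by simp
      also have "\<dots> = D * (v r * (\<Sum>l<n. norm (b l) * r ^ l))" by simp
      also have "\<dots> \<le> D * C" using C[OF r] \<open>D \<ge> 0\<close> by (intro mult_left_mono)
      finally show "v r * (\<Sum>l<n. norm (b l * u l) * r ^ l) \<le> D * C" .
    qed
  qed
qed

section \<open>Blocks and geometric decay\<close>

text \<open>
  In natural-number arithmetic \<open>(k - j) + (j - k)\<close> is the distance of \<open>j\<close> and \<open>k\<close>.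
\<close>

lemma two_sided_geometric_sum_le:
  fixes q :: real
  assumes "0 \<le> q" "q < 1"
  shows "(\<Sum>j\<le>N. q ^ ((k - j) + (j - k))) \<le> 2 / (1 - q)"
proof -
  have geo: "(\<Sum>i\<le>n. q ^ i) \<le> 1 / (1 - q)" for n
    using assms by (auto simp: sum_gp0 intro!: divide_right_mono)
  have "(\<Sum>j\<le>N. q ^ ((k - j) + (j - k))) \<le> (\<Sum>j\<in>{..k} \<union> {k..k+N}. q ^ ((k - j) + (j - k)))"
    using assms by (intro sum_mono2) auto
  also have "\<dots> \<le> (\<Sum>j\<le>k. q ^ ((k - j) + (j - k))) + (\<Sum>j\<in>{k..k+N}. q ^ ((k - j) + (j - k)))"
    using assms by (subst sum_Un) (auto intro: sum_nonneg)
  also have "(\<Sum>j\<le>k. q ^ ((k - j) + (j - k))) = (\<Sum>i\<le>k. q ^ i)"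
    by (rule sum.reindex_bij_witness[of _ "\<lambda>i. k - i" "\<lambda>i. k - i"]) auto
  also have "(\<Sum>j\<in>{k..k+N}. q ^ ((k - j) + (j - k))) = (\<Sum>i\<le>N. q ^ i)"
    by (rule sum.reindex_bij_witness[of _ "\<lambda>i. k + i" "\<lambda>i. i - k"]) auto
  also have "(\<Sum>i\<le>k. q ^ i) + (\<Sum>i\<le>N. q ^ i) \<le> 2 / (1 - q)"
    using geo[of k] geo[of N] by simp
  finally show ?thesis by simp
qed

lemma power_exchange_le:
  fixes s t :: real
  assumes "0 \<le> t" "t \<le> s" "l \<le> n"
  shows "s ^ l * t ^ n \<le> s ^ n * t ^ l"
proof -
  have "(s ^ l * t ^ l) * t ^ (n - l) \<le> (s ^ l * t ^ l) * s ^ (n - l)"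
    using assms by (intro mult_left_mono power_mono) auto
  moreover have "t ^ n = t ^ l * t ^ (n - l)" "s ^ n = s ^ l * s ^ (n - l)"
    using assms(3) by (simp_all add: power_add[symmetric])
  ultimately show ?thesis by (simp add: mult_ac)
qed

lemma weighted_power_sum_le:
  fixes s t :: real and w :: "nat \<Rightarrow> real"
  assumes "\<And>l. l \<in> I \<Longrightarrow> 0 \<le> w l"
    and le: "\<And>l. l \<in> I \<Longrightarrow> s ^ l * t ^ n \<le> s ^ n * t ^ l"
  shows "(\<Sum>l\<in>I. w l * s ^ l) * t ^ n \<le> s ^ n * (\<Sum>l\<in>I. w l * t ^ l)"
  unfolding sum_distrib_left sum_distrib_right
proof (rule sum_mono)
  fix l assume "l \<in> I"
  from mult_left_mono[OF le[OF this] assms(1)[OF this]]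
  show "w l * s ^ l * t ^ n \<le> s ^ n * (w l * t ^ l)" by (simp add: mult_ac)
qed

text \<open>
  The indices \<open>a\<^sub>j\<close>, \<open>j \<ge> 1\<close>, cut the exponents into the blocks \<open>a\<^sub>j < l \<le> a\<^bsub>j+1\<^esub>\<close>.  Each bound is
  stated separately because each has its own use: \<open>A_ge\<close> and \<open>B_ge\<close> give decay on the two sides
  of a point, \<open>B_le\<close> limits the loss in comparing a block with its value at its left-hand node.
\<close>

locale regular_blocks =
  fixes M :: "nat \<Rightarrow> real" and a :: "nat \<Rightarrow> nat" and \<beta> K :: real
  assumes M: "M \<in> LC"
    and a: "strict_mono_on {1..} a"
    and \<beta>: "1 < \<beta>"
    and A_ge: "1 \<le> j \<Longrightarrow> \<beta> \<le> A_quot M (a j) (a (j + 1))"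
    and B_ge: "1 \<le> j \<Longrightarrow> \<beta> \<le> B_quot M (a j) (a (j + 1))"
    and B_le: "1 \<le> j \<Longrightarrow> B_quot M (a j) (a (j + 1)) \<le> K"
begin

definition node :: "nat \<Rightarrow> real" where
  "node j = mu M (a j + 1)"

lemma node_pos: "0 < node j"
  by (simp add: node_def mu_pos[OF M])

lemma a_mono: "1 \<le> i \<Longrightarrow> i \<le> j \<Longrightarrow> a i \<le> a j"
  using a by (cases "i = j") (auto simp: strict_mono_on_def less_imp_le)

lemma node_mono: "1 \<le> i \<Longrightarrow> i \<le> j \<Longrightarrow> node i \<le> node j"
  by (simp add: node_def mu_mono[OF M] a_mono)

text \<open>
  The product in \<open>A_quot\<close> and \<open>B_quot\<close> is the quotient of \<open>M\<close> at the two ends of the block, so the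
  bounds compare the growth of \<open>M\<close> over a block with a power of the node at its right or left end.
\<close>

lemma node_powers:
  assumes "1 \<le> j"
  shows node_Suc_power: "\<beta> * M (a (j + 1)) \<le> M (a j) * node (j + 1) ^ (a (j + 1) - a j)"
    and node_power_lower: "\<beta> * M (a j) * node j ^ (a (j + 1) - a j) \<le> M (a (j + 1))"
    and node_power_upper: "M (a (j + 1)) \<le> K * M (a j) * node j ^ (a (j + 1) - a j)"
proof -
  let ?P = "\<Prod>i=a j+1..a (j+1). mu M i"
  have P: "?P > 0" by (intro prod_pos) (simp add: mu_pos[OF M])
  have r: "M (a (j + 1)) = M (a j) * ?P"
    using assms by (intro LC_ratio[OF M] a_mono) auto
  have pos: "M (a j) > 0" by (rule LC_pos[OF M])
  have "\<beta> * ?P \<le> node (j + 1) ^ (a (j + 1) - a j)"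
    using A_ge[OF assms] P by (simp add: A_quot_def node_def pos_le_divide_eq)
  from mult_left_mono[OF this less_imp_le[OF pos]]
  show "\<beta> * M (a (j + 1)) \<le> M (a j) * node (j + 1) ^ (a (j + 1) - a j)"
    unfolding r by (simp add: mult_ac)
  have n: "node j ^ (a (j + 1) - a j) > 0" by (simp add: node_pos)
  have "\<beta> * node j ^ (a (j + 1) - a j) \<le> ?P"
    using B_ge[OF assms] n by (simp add: B_quot_def node_def pos_le_divide_eq)
  from mult_left_mono[OF this less_imp_le[OF pos]]
  show "\<beta> * M (a j) * node j ^ (a (j + 1) - a j) \<le> M (a (j + 1))"
    unfolding r by (simp add: mult_ac)
  have "?P \<le> K * node j ^ (a (j + 1) - a j)"
    using B_le[OF assms] n by (simp add: B_quot_def node_def pos_divide_le_eq)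
  from mult_left_mono[OF this less_imp_le[OF pos]]
  show "M (a (j + 1)) \<le> K * M (a j) * node j ^ (a (j + 1) - a j)"
    unfolding r by (simp add: mult_ac)
qed

text \<open>
  To the right of \<open>node k\<close> the bound \<open>M (a k) / s ^ a k\<close> for the weight beats the one with an
  earlier index \<open>a m\<close>, by a factor \<open>\<beta>\<close> for each block between them: \<open>s\<close> lies to the right
  of the right-hand node of each of these blocks, so \<open>node_Suc_power\<close> applies to them all.
\<close>

lemma decay_above_node:
  assumes "1 \<le> m" "m \<le> k" "node k \<le> s"
  shows "\<beta> ^ (k - m) * M (a k) \<le> M (a m) * s ^ (a k - a m)"
  using assms(2,3)
proof (induction k rule: dec_induct)
  case base
  show ?case by simp
next
  case (step k)
  have k: "1 \<le> k" "a m \<le> a k" "a k \<le> a (Suc k)" "node k \<le> node (Suc k)"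
    using assms(1) step.hyps by (auto intro: a_mono node_mono)
  have "\<beta> ^ (Suc k - m) * M (a (Suc k)) = \<beta> ^ (k - m) * (\<beta> * M (a (Suc k)))"
    using step.hyps by (simp add: Suc_diff_le)
  also have "\<dots> \<le> \<beta> ^ (k - m) * (M (a k) * node (Suc k) ^ (a (Suc k) - a k))"
    using node_Suc_power[OF k(1)] \<beta> by (intro mult_left_mono) auto
  also have "\<dots> \<le> \<beta> ^ (k - m) * (M (a k) * s ^ (a (Suc k) - a k))"
    using step.prems node_pos[of "Suc k"] \<beta> LC_pos[OF M]
    by (intro mult_left_mono power_mono) (auto intro: less_imp_le)
  also have "\<dots> = (\<beta> ^ (k - m) * M (a k)) * s ^ (a (Suc k) - a k)" by simp
  also have "\<dots> \<le> (M (a m) * s ^ (a k - a m)) * s ^ (a (Suc k) - a k)"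
    using step.IH step.prems k node_pos[of "Suc k"] by (intro mult_right_mono) auto
  also have "\<dots> = M (a m) * s ^ (a (Suc k) - a m)"
    using k by (simp add: power_add[symmetric])
  finally show ?case .
qed

text \<open>
  The mirror image of \<open>decay_above_node\<close>: to the left of \<open>node m\<close> the weight bound with index
  \<open>a m\<close> beats the one with a later index \<open>a k\<close>, now by \<open>node_power_lower\<close>.
\<close>

lemma decay_below_node:
  assumes "1 \<le> m" "m \<le> k" "0 \<le> s" "s \<le> node m"
  shows "\<beta> ^ (k - m) * M (a m) * s ^ (a k - a m) \<le> M (a k)"
  using assms(2)
proof (induction k rule: dec_induct)
  case base
  show ?case by simp
next
  case (step k)
  have k: "1 \<le> k" "a m \<le> a k" "a k \<le> a (Suc k)" "s \<le> node k"
    using assms step.hyps node_mono[of m k] by (auto intro: a_mono)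
  have e: "a (Suc k) - a m = (a k - a m) + (a (Suc k) - a k)"
    using k by simp
  have "\<beta> ^ (Suc k - m) * M (a m) * s ^ (a (Suc k) - a m) =
      \<beta> * (\<beta> ^ (k - m) * M (a m) * s ^ (a k - a m)) * s ^ (a (Suc k) - a k)"
    unfolding e using step.hyps by (simp add: Suc_diff_le power_add)
  also have "\<dots> \<le> \<beta> * M (a k) * s ^ (a (Suc k) - a k)"
    using step.IH \<beta> assms(3) by (intro mult_right_mono mult_left_mono) auto
  also have "\<dots> \<le> \<beta> * M (a k) * node k ^ (a (Suc k) - a k)"
    using k assms(3) \<beta> LC_pos[OF M, of "a k"] by (intro mult_left_mono power_mono) auto
  also have "\<dots> \<le> M (a (Suc k))"
    using node_power_lower[OF k(1)] by simp
  finally show ?case .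
qed

lemma sum_blocks:
  fixes g :: "nat \<Rightarrow> real"
  shows "(\<Sum>l\<le>a (N + 1). g l) = (\<Sum>l\<le>a 1. g l) + (\<Sum>j=1..N. \<Sum>l\<in>{a j<..a (j + 1)}. g l)"
proof (induction N)
  case 0
  show ?case by simp
next
  case (Suc N)
  have "a (N + 1) \<le> a (Suc N + 1)" by (intro a_mono) auto
  then have "{..a (Suc N + 1)} = {..a (N + 1)} \<union> {a (N + 1)<..a (Suc N + 1)}" by auto
  then have "(\<Sum>l\<le>a (Suc N + 1). g l) = (\<Sum>l\<le>a (N + 1). g l) + (\<Sum>l\<in>{a (N + 1)<..a (Suc N + 1)}. g l)"
    by (simp only:) (subst sum.union_disjoint, auto)
  then show ?case using Suc.IH by simp
qed

text \<open>
  The shift by two accounts for \<open>a\<close> being increasing only from index 1 on, where \<open>a 1\<close> may be 0.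
\<close>

lemma index_less_a: "n < a (n + 2)"
proof (induction n)
  case 0
  have "a 1 < a 2" using a by (auto simp: strict_mono_on_def)
  then show ?case by (simp add: numeral_2_eq_2)
next
  case (Suc n)
  have "a (n + 2) < a (Suc n + 2)" using a by (auto simp: strict_mono_on_def)
  then show ?case using Suc by simp
qed

text \<open>
  By \<open>weight_at_mu\<close>, the hypothesis \<open>C\<close> below says that the \<open>j\<close>-th block of \<open>\<Sum>\<^sub>l w\<^sub>l s\<^sup>l\<close>, taken at
  its left-hand node and multiplied by the weight there, is at most \<open>C\<close>; clearing the
  denominator leaves a polynomial inequality.
\<close>

context
  fixes w :: "nat \<Rightarrow> real" and C :: real
  assumes w: "\<And>l. 0 \<le> w l"
    and C: "\<And>j. 1 \<le> j \<Longrightarrow> M (a j) * (\<Sum>l\<in>{a j<..a (j + 1)}. w l * node j ^ l) \<le> C * node j ^ a j"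
begin

lemma C_nonneg: "0 \<le> C"
proof -
  have "0 \<le> M (a 1) * (\<Sum>l\<in>{a 1<..a (1 + 1)}. w l * node 1 ^ l)"
    using w LC_pos[OF M, of "a 1"] node_pos[of 1]
    by (intro mult_nonneg_nonneg sum_nonneg) auto
  then have "0 \<le> C * node 1 ^ a 1" using C[of 1] by simp
  then show ?thesis
    using zero_less_power[OF node_pos[of 1], of "a 1"] zero_le_mult_iff[of C "node 1 ^ a 1"] by linarith
qed

text \<open>
  When \<open>s\<close> moves to the right, the block grows at most like its top power \<open>s ^ a (j + 1)\<close>.  A factor
  \<open>x\<close> that compensates this power up to \<open>M (a (j + 1))\<close> loses only the deviation of
  \<open>M (a (j + 1))\<close> from the power of \<open>node j\<close>, which is \<open>B_quot\<close> and so at most \<open>K\<close>.  The factor \<open>x\<close>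
  will be the weight at \<open>s\<close> times the gain \<open>\<beta> ^ d\<close> over \<open>d\<close> blocks.
\<close>

lemma block_right_of_node:
  assumes "1 \<le> j" "node j \<le> s" "0 \<le> x" "x * s ^ a (j + 1) \<le> M (a (j + 1))"
  shows "x * (\<Sum>l\<in>{a j<..a (j + 1)}. w l * s ^ l) \<le> C * K"
proof -
  let ?n = "a (j + 1)" and ?t = "node j" and ?I = "{a j<..a (j + 1)}"
  have t: "0 < ?t" by (rule node_pos)
  have n: "a j \<le> ?n" using assms(1) by (simp add: a_mono)
  have D0: "0 \<le> (\<Sum>l\<in>?I. w l * ?t ^ l)" using w t by (intro sum_nonneg) auto
  have K0: "0 \<le> K" using B_ge[of 1] B_le[of 1] \<beta> by simp
  have "(\<Sum>l\<in>?I. w l * s ^ l) * ?t ^ ?n \<le> s ^ ?n * (\<Sum>l\<in>?I. w l * ?t ^ l)"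
    using assms t by (intro weighted_power_sum_le power_exchange_le w) auto
  from mult_left_mono[OF this assms(3)]
  have "x * (\<Sum>l\<in>?I. w l * s ^ l) * ?t ^ ?n \<le> (x * s ^ ?n) * (\<Sum>l\<in>?I. w l * ?t ^ l)"
    by (simp add: mult_ac)
  also have "\<dots> \<le> (K * M (a j) * ?t ^ (?n - a j)) * (\<Sum>l\<in>?I. w l * ?t ^ l)"
    using assms(4) node_power_upper[OF assms(1)] D0 by (intro mult_right_mono) auto
  also have "\<dots> = K * ?t ^ (?n - a j) * (M (a j) * (\<Sum>l\<in>?I. w l * ?t ^ l))" by simp
  also have "\<dots> \<le> K * ?t ^ (?n - a j) * (C * ?t ^ a j)"
    using C[OF assms(1)] K0 t by (intro mult_left_mono) auto
  also have "\<dots> = C * K * (?t ^ (?n - a j) * ?t ^ a j)" by simp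
  also have "?t ^ (?n - a j) * ?t ^ a j = ?t ^ ?n" using n by (simp add: power_add[symmetric])
  finally show ?thesis using t by simp
qed

text \<open>
  When \<open>s\<close> moves to the left, every power in the block shrinks at least as fast as \<open>s ^ a j\<close>, the
  power in which the block bound at \<open>node j\<close> is expressed; so no constant is lost.
\<close>

lemma block_left_of_node:
  assumes "1 \<le> j" "0 \<le> s" "s \<le> node j" "0 \<le> x" "x * s ^ a j \<le> M (a j)"
  shows "x * (\<Sum>l\<in>{a j<..a (j + 1)}. w l * s ^ l) \<le> C"
proof -
  let ?n = "a j" and ?t = "node j" and ?I = "{a j<..a (j + 1)}"
  have t: "0 < ?t" by (rule node_pos)
  have D0: "0 \<le> (\<Sum>l\<in>?I. w l * ?t ^ l)" using w t by (intro sum_nonneg) auto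
  have "s ^ l * ?t ^ ?n \<le> s ^ ?n * ?t ^ l" if "l \<in> ?I" for l
    using power_exchange_le[of s ?t ?n l] assms that by (simp add: mult.commute)
  then have "(\<Sum>l\<in>?I. w l * s ^ l) * ?t ^ ?n \<le> s ^ ?n * (\<Sum>l\<in>?I. w l * ?t ^ l)"
    by (intro weighted_power_sum_le w)
  from mult_left_mono[OF this assms(4)]
  have "x * (\<Sum>l\<in>?I. w l * s ^ l) * ?t ^ ?n \<le> (x * s ^ ?n) * (\<Sum>l\<in>?I. w l * ?t ^ l)"
    by (simp add: mult_ac)
  also have "\<dots> \<le> M ?n * (\<Sum>l\<in>?I. w l * ?t ^ l)"
    using assms(5) D0 by (intro mult_right_mono) auto
  also have "\<dots> \<le> C * ?t ^ ?n" by (rule C[OF assms(1)])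
  finally show ?thesis using t by simp
qed

text \<open>
  Here \<open>h\<close> stands for the weight at \<open>s\<close>, and \<open>k\<close> for the index with \<open>s\<close> between \<open>node k\<close> and
  \<open>node (k + 1)\<close>.  Only \<open>\<bar>k - j\<bar> - 1\<close> full blocks lie between \<open>s\<close> and the \<open>j\<close>-th block, which is
  why the constant contains an additional \<open>\<beta>\<close>.  The side conditions are restricted by the position
  of \<open>j\<close> so that \<open>k = 0\<close> can represent a point to the left of all nodes.
\<close>

lemma block_decay:
  assumes "0 < s" "0 \<le> h" and h: "\<And>p. h * s ^ p \<le> M p"
    and j: "1 \<le> j"
    and below: "j \<le> k \<Longrightarrow> node k \<le> s" and above: "k < j \<Longrightarrow> s \<le> node (k + 1)"
  shows "h * (\<Sum>l\<in>{a j<..a (j + 1)}. w l * s ^ l) \<le> C * K * \<beta> * (1 / \<beta>) ^ ((k - j) + (j - k))"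
proof -
  let ?S = "\<Sum>l\<in>{a j<..a (j + 1)}. w l * s ^ l"
  have K1: "1 \<le> K" using B_ge[of 1] B_le[of 1] \<beta> by simp
  consider "j < k" | "j = k" | "k < j" by linarith
  then show ?thesis
  proof cases
    case 1
    let ?d = "k - (j + 1)"
    have ak: "a (j + 1) \<le> a k" using 1 j by (intro a_mono) auto
    have "h * \<beta> ^ ?d * s ^ a (j + 1) \<le> M (a (j + 1))"
    proof -
      have "(h * \<beta> ^ ?d * s ^ a (j + 1)) * s ^ (a k - a (j + 1)) = \<beta> ^ ?d * (h * s ^ a k)"
        using ak by (simp add: power_add[symmetric] mult_ac)
      also have "\<dots> \<le> \<beta> ^ ?d * M (a k)"
        using h \<beta> by (intro mult_left_mono) auto
      also have "\<dots> \<le> M (a (j + 1)) * s ^ (a k - a (j + 1))"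
        using 1 j below by (intro decay_above_node) auto
      finally show ?thesis using \<open>0 < s\<close> by simp
    qed
    moreover have "node j \<le> s"
      using node_mono[OF j, of k] 1 below by simp
    ultimately have "h * \<beta> ^ ?d * ?S \<le> C * K"
      using j \<open>0 \<le> h\<close> \<beta> by (intro block_right_of_node) auto
    then have "h * ?S \<le> C * K / \<beta> ^ ?d"
      using \<beta> by (simp add: pos_le_divide_eq mult_ac)
    also have "\<dots> = C * K * \<beta> * (1 / \<beta>) ^ Suc ?d"
      using \<beta> by (simp add: power_one_over field_simps)
    also have "Suc ?d = (k - j) + (j - k)" using 1 by simp
    finally show ?thesis .
  next
    case 2
    have "h * ?S \<le> C * K"
      using j h \<open>0 \<le> h\<close> below 2 by (intro block_right_of_node) auto
    also have "\<dots> \<le> C * K * \<beta>"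
      using mult_left_mono[of 1 \<beta> "C * K"] C_nonneg K1 \<beta> by simp
    finally show ?thesis using 2 by simp
  next
    case 3
    let ?d = "j - (k + 1)"
    have ak: "a (k + 1) \<le> a j" using 3 by (intro a_mono) auto
    have "h * \<beta> ^ ?d * s ^ a j \<le> M (a j)"
    proof -
      have "h * \<beta> ^ ?d * s ^ a j = (h * s ^ a (k + 1)) * (\<beta> ^ ?d * s ^ (a j - a (k + 1)))"
        using ak by (simp add: power_add[symmetric] mult_ac)
      also have "\<dots> \<le> M (a (k + 1)) * (\<beta> ^ ?d * s ^ (a j - a (k + 1)))"
        using h \<beta> \<open>0 < s\<close> by (intro mult_right_mono) auto
      also have "\<dots> \<le> M (a j)"
        using decay_below_node[of "k + 1" j s] 3 above \<open>0 < s\<close> by (simp add: mult_ac)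
      finally show ?thesis .
    qed
    moreover have "s \<le> node j"
      using node_mono[of "k + 1" j] 3 above by simp
    ultimately have "h * \<beta> ^ ?d * ?S \<le> C"
      using j \<open>0 \<le> h\<close> \<beta> \<open>0 < s\<close> by (intro block_left_of_node) auto
    then have "h * ?S \<le> C / \<beta> ^ ?d"
      using \<beta> by (simp add: pos_le_divide_eq mult_ac)
    also have "\<dots> \<le> C * K / \<beta> ^ ?d"
      using C_nonneg K1 \<beta> mult_left_mono[of 1 K C] by (intro divide_right_mono) auto
    also have "\<dots> = C * K * \<beta> * (1 / \<beta>) ^ Suc ?d"
      using \<beta> by (simp add: power_one_over field_simps)
    also have "Suc ?d = (k - j) + (j - k)" using 3 by simp
    finally show ?thesis .
  qed
qed

text \<open>
  A partial sum meets finitely many blocks, so \<open>k\<close> can be taken as the last of those blocks whose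
  node does not exceed \<open>s\<close>.  The exponents up to \<open>a 1\<close>, which belong to no block, are bounded term
  by term through \<open>h s\<^sup>l \<le> M\<^sub>l\<close>.
\<close>

lemma partial_sums_bounded:
  assumes "0 < s" "0 \<le> h" and h: "\<And>p. h * s ^ p \<le> M p"
  shows "h * (\<Sum>l<n. w l * s ^ l) \<le>
    (\<Sum>l\<le>a 1. w l * M l) + C * K * \<beta> * (2 / (1 - 1 / \<beta>))"
proof -
  define N where "N = n + 1"
  \<comment> \<open>The inserted 0 is the value if \<open>s\<close> lies to the left of all the nodes considered.\<close>
  define k where "k = Max (insert 0 {j\<in>{1..N}. node j \<le> s})"
  have K0: "0 \<le> K" using B_ge[of 1] B_le[of 1] \<beta> by simp
  have kin: "k \<in> insert 0 {j\<in>{1..N}. node j \<le> s}"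
    unfolding k_def by (rule Max_in) auto
  have below: "node k \<le> s" if "1 \<le> j" "j \<le> k" for j
    using kin that by auto
  have above: "s \<le> node (k + 1)" if "k < j" "j \<le> N" for j
  proof (rule ccontr)
    assume "\<not> s \<le> node (k + 1)"
    then have "k + 1 \<in> insert 0 {j\<in>{1..N}. node j \<le> s}"
      using that by auto
    then have "k + 1 \<le> k"
      by (subst (2) k_def, intro Max_ge) auto
    then show False by simp
  qed
  have q: "0 \<le> 1 / \<beta>" "1 / \<beta> < 1" using \<beta> by auto
  have "{..<n} \<subseteq> {..a (N + 1)}"
    using index_less_a[of n] by (auto simp: N_def)
  then have "(\<Sum>l<n. w l * s ^ l) \<le> (\<Sum>l\<le>a (N + 1). w l * s ^ l)"
    using w \<open>0 < s\<close> by (intro sum_mono2) auto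
  from mult_left_mono[OF this \<open>0 \<le> h\<close>]
  have "h * (\<Sum>l<n. w l * s ^ l) \<le>
      (\<Sum>l\<le>a 1. h * (w l * s ^ l)) + (\<Sum>j=1..N. h * (\<Sum>l\<in>{a j<..a (j + 1)}. w l * s ^ l))"
    unfolding sum_blocks by (simp add: distrib_left sum_distrib_left)
  also have "\<dots> \<le> (\<Sum>l\<le>a 1. w l * M l) + (\<Sum>j=1..N. C * K * \<beta> * (1 / \<beta>) ^ ((k - j) + (j - k)))"
  proof (intro add_mono sum_mono)
    fix l
    show "h * (w l * s ^ l) \<le> w l * M l"
      using mult_left_mono[OF h w, of l l] by (simp add: mult_ac)
  next
    fix j assume "j \<in> {1..N}"
    then show "h * (\<Sum>l\<in>{a j<..a (j + 1)}. w l * s ^ l) \<le> C * K * \<beta> * (1 / \<beta>) ^ ((k - j) + (j - k))"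
      using assms below above by (intro block_decay) auto
  qed
  also have "(\<Sum>j=1..N. C * K * \<beta> * (1 / \<beta>) ^ ((k - j) + (j - k))) \<le>
      C * K * \<beta> * (\<Sum>j\<le>N. (1 / \<beta>) ^ ((k - j) + (j - k)))"
    unfolding sum_distrib_left using C_nonneg K0 \<beta> by (intro sum_mono2) auto
  also have "\<dots> \<le> C * K * \<beta> * (2 / (1 - 1 / \<beta>))"
    using two_sided_geometric_sum_le[OF q] C_nonneg K0 \<beta> by (intro mult_left_mono) auto
  finally show ?thesis by simp
qed

end

end

section \<open>The solid core in terms of block sums\<close>

theorem theorem4p4:
  fixes M :: "nat \<Rightarrow> real" and c :: real and a :: "nat \<Rightarrow> nat" and \<beta> K :: real
  assumes "M \<in> LC" and "c > 0"
    and "strict_mono_on {1..} a"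
    and "K \<ge> \<beta>" and "\<beta> > 2"
    and "\<And>j. j \<ge> 1 \<Longrightarrow>
           \<beta> \<le> min (A_quot M (a j) (a (j + 1))) (B_quot M (a j) (a (j + 1))) \<and>
           max (A_quot M (a j) (a (j + 1))) (B_quot M (a j) (a (j + 1))) \<le> K"
  shows "solid_core (H_inf_seq (weight M c)) =
           {b. bdd_above ((\<lambda>j. weight M c (mu M (a j + 1) / c) *
                 (\<Sum>l\<in>{a j<..a (j + 1)}. norm (b l) * (mu M (a j + 1) / c) ^ l)) ` {1..})} \<and>
         solid_core (H_inf_seq (weight M c)) =
           {b. bdd_above ((\<lambda>j. M (a j + 1) / mu M (a j + 1) ^ (a j + 1) *
                 (\<Sum>l\<in>{a j<..a (j + 1)}. norm (b l) * (mu M (a j + 1) / c) ^ l)) ` {1..})}"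
proof -
  let ?v = "weight M c"
  let ?r = "\<lambda>j. mu M (a j + 1) / c"
  let ?block = "\<lambda>b j. \<Sum>l\<in>{a j<..a (j + 1)}. norm (b l) * ?r j ^ l"
  interpret regular_blocks M a \<beta> K
    using assms by unfold_locales auto
  have v: "?v r > 0" for r by (simp add: weight_def)
  have "b \<in> solid_core (H_inf_seq ?v) \<longleftrightarrow> bdd_above ((\<lambda>j. ?v (?r j) * ?block b j) ` {1..})"
    for b :: "nat \<Rightarrow> complex"
  proof
    assume "b \<in> solid_core (H_inf_seq ?v)"
    then obtain C where C: "\<And>r n. r \<ge> 0 \<Longrightarrow> ?v r * (\<Sum>l<n. norm (b l) * r ^ l) \<le> C"
      using v by (auto simp: solid_core_H_inf_iff)
    have "?v (?r j) * ?block b j \<le> C" for j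
    proof -
      have r: "?r j \<ge> 0" using mu_pos[OF \<open>M \<in> LC\<close>, of "a j + 1"] \<open>c > 0\<close> by simp
      have "?block b j \<le> (\<Sum>l<Suc (a (j + 1)). norm (b l) * ?r j ^ l)"
        using r by (intro sum_mono2) auto
      then have "?v (?r j) * ?block b j \<le> ?v (?r j) * (\<Sum>l<Suc (a (j + 1)). norm (b l) * ?r j ^ l)"
        using v[of "?r j"] by simp
      also have "\<dots> \<le> C" by (rule C[OF r])
      finally show ?thesis .
    qed
    then show "bdd_above ((\<lambda>j. ?v (?r j) * ?block b j) ` {1..})" by (auto simp: bdd_above_def)
  next
    assume "bdd_above ((\<lambda>j. ?v (?r j) * ?block b j) ` {1..})"
    then obtain C where C: "\<And>j. 1 \<le> j \<Longrightarrow> ?v (?r j) * ?block b j \<le> C"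
      by (auto simp: bdd_above_def)
    \<comment> \<open>Dividing by \<open>c ^ l\<close> turns \<open>r\<close> into \<open>c * r\<close>, the argument at which \<open>omega\<close> is taken.\<close>
    define w where "w l = norm (b l) / c ^ l" for l
    have w: "0 \<le> w l" for l using \<open>c > 0\<close> by (simp add: w_def)
    have wC: "M (a j) * (\<Sum>l\<in>{a j<..a (j + 1)}. w l * node j ^ l) \<le> C * node j ^ a j" if "1 \<le> j" for j
    proof -
      have "(\<Sum>l\<in>{a j<..a (j + 1)}. w l * node j ^ l) = ?block b j"
        by (simp add: w_def node_def power_divide)
      then show ?thesis
        using C[OF that] node_pos[of j] \<open>M \<in> LC\<close> \<open>c > 0\<close>
        by (simp add: weight_at_mu[simplified] node_def field_simps)
    qed
    define D where "D = (\<Sum>l\<le>a 1. w l * M l) + C * K * \<beta> * (2 / (1 - 1 / \<beta>))"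
    \<comment> \<open>At \<open>r = 0\<close> the weight is 1 by convention and only the constant coefficient survives.\<close>
    have "?v r * (\<Sum>l<n. norm (b l) * r ^ l) \<le> max D (norm (b 0))" if "r \<ge> 0" for r n
    proof (cases "r = 0")
      case True
      have "(\<Sum>l<n. norm (b l) * 0 ^ l) \<le> norm (b 0)"
        by (cases n) (auto simp: sum.lessThan_Suc_shift)
      then show ?thesis using True by (simp add: weight_def omega_def max.coboundedI2)
    next
      case False
      then have r: "r > 0" using that by simp
      have "(\<Sum>l<n. norm (b l) * r ^ l) = (\<Sum>l<n. w l * (c * r) ^ l)"
        using \<open>c > 0\<close> by (simp add: w_def power_mult_distrib)
      moreover have "?v r * (\<Sum>l<n. w l * (c * r) ^ l) \<le> D"
        unfolding D_def
        using r \<open>c > 0\<close> v[of r] weight_times_power_le[OF \<open>M \<in> LC\<close> \<open>c > 0\<close> r]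
        by (intro partial_sums_bounded[OF w wC]) auto
      ultimately show ?thesis by simp
    qed
    then show "b \<in> solid_core (H_inf_seq ?v)"
      using v by (auto simp: solid_core_H_inf_iff)
  qed
  then have main: "solid_core (H_inf_seq ?v) =
      {b. bdd_above ((\<lambda>j. ?v (?r j) * ?block b j) ` {1..})}"
    by (intro set_eqI) (simp only: mem_Collect_eq)
  then show ?thesis
    by (simp only: weight_at_mu_Suc[OF \<open>M \<in> LC\<close> \<open>c > 0\<close>] simp_thms)
qed

end
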